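(* Let $\Bbbk$ be an algebraically closed field of characteristic zero and let $A_{c,q}=\Bbbk[x,y,z]/(c(x)z-q(x,y))$ be a Danielewski-type algebra in reduced form with $\deg(c)\ge2$ and $\deg_y(q)\ge2$. Let $D\in\operatorname{Der}(A_{c,q})$ be a simple derivation. Suppose that every automorphism $\sigma\in\operatorname{Aut}(A_{c,q})$ such that $\psi(\sigma)\neq(1,1)$ fixes a maximal ideal of $A_{c,q}$ (i.e. $\sigma(\mathfrak m)=\mathfrak m$ for some maximal ideal $\mathfrak m$). Then $\operatorname{Aut}_D(A_{c,q})=\{\operatorname{id}\}$.
   Context: Here $c(x)\in\Bbbk[x]$, and $q(x,y)\in\Bbbk[x,y]$ is quasi-monic in $y$, i.e. the coefficient of the highest power of $y$ is in $\Bbbk^*$. A polynomial of degree $m$ is centered if its coefficient in degree $m-1$ is zero. $A_{c,q}$ is in reduced form if $c(x)$ is centered, $q(x,y)$ is centered as a polynomial in $y$ over $\Bbbk[x]$, and $\deg_x(q)<\deg(c)$. Put $n=\deg(c)$, $d=\deg_y(q)$, and \[ G_{c,q}=\{(e,u)\in\Bbbk^*\times\Bbbk^*\mid c(ex)=e^nc(x),\ q(ex,uy)=u^dq(x,y)\}. \] $\bar x,\bar y,\bar z$ denote the images of $x,y,z$ in $A_{c,q}$. It is a known structural fact that every $\Bbbk$-algebra automorphism $\sigma$ of $A_{c,q}$ satisfies $\sigma(\bar x)=e\bar x$, $\sigma(\bar y)=u\bar y+c(\bar x)\ell(\bar x)$ for some $(e,u)\in G_{c,q}$ and $\ell\in\Bbbk[x]$;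 the canonical homomorphism $\psi:\operatorname{Aut}(A_{c,q})\to G_{c,q}$ is $\psi(\sigma)=(e,u)$. It is a surjective (split) group homomorphism with kernel $U_{\Bbbk}(A_{c,q})=\{\exp(\ell(\bar x)\xi_{c,q})\mid\ell\in\Bbbk[x]\}$, where $\xi_{c,q}$ is the locally nilpotent derivation with $\xi_{c,q}(\bar x)=0$, $\xi_{c,q}(\bar y)=c(\bar x)$, $\xi_{c,q}(\bar z)=\partial_yq(\bar x,\bar y)$. $\operatorname{Der}(A)$ is the space of $\Bbbk$-derivations; $D$ is simple if the only ideals $I\subseteq A$ with $D(I)\subseteq I$ are $0$ and $A$; $\operatorname{Aut}_D(A)$ is the group of $\Bbbk$-algebra automorphisms $\sigma$ of $A$ with $\sigma D=D\sigma$. *)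

theory Defs
  imports
    "HOL-Algebra.Algebraic_Closure_Type"
    "HOL-Algebra.QuotRing"
    "HOL-Computational_Algebra.Polynomial"
begin

text \<open>
  The polynomial rings are iterated univariate ones: \<open>'a poly\<close> is $k[x]$,
  \<open>'a poly poly\<close> is $k[x][y] = k[x,y]$ and \<open>'a poly poly poly\<close> is $k[x,y][z]$, so that
  \<open>x = [:[:[:0, 1:]:]:]\<close>, \<open>y = [:[:0, 1:]:]\<close>, \<open>z = [:0, 1:]\<close> in the last ring.
  In particular, for \<open>q :: 'a poly poly\<close> the degree in $y$ is \<open>degree q\<close>.
\<close>

definition deg_x :: "'a::zero poly poly \<Rightarrow> nat" where
  "deg_x q = Max ((\<lambda>i. degree (coeff q i)) ` {..degree q})"

definition quasi_monic :: "'a::field poly poly \<Rightarrow> bool" where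
  "quasi_monic q \<longleftrightarrow> (\<exists>a. a \<noteq> 0 \<and> lead_coeff q = [:a:])"

definition centered :: "'b::zero poly \<Rightarrow> bool" where
  "centered p \<longleftrightarrow> (\<forall>m. degree p = Suc m \<longrightarrow> coeff p m = 0)"

definition reduced_form :: "'a::field poly \<Rightarrow> 'a poly poly \<Rightarrow> bool" where
  "reduced_form c q \<longleftrightarrow>
     quasi_monic q \<and> centered c \<and> centered q \<and> deg_x q < degree c"

text \<open>The algebra $A_{c,q} = k[x,y,z]/(c(x)z - q(x,y))$.\<close>

definition dan_rel :: "'a::field poly \<Rightarrow> 'a poly poly \<Rightarrow> 'a poly poly poly" where
  "dan_rel c q = [:[:c:]:] * [:0, 1:] - [:q:]"

definition dan_ideal :: "'a::field poly \<Rightarrow> 'a poly poly \<Rightarrow> 'a poly poly poly set" where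
  "dan_ideal c q = PIdl\<^bsub>ring_of_type_algebra\<^esub> (dan_rel c q)"

definition dan_alg :: "'a::field poly \<Rightarrow> 'a poly poly \<Rightarrow> 'a poly poly poly set ring" where
  "dan_alg c q = ring_of_type_algebra Quot (dan_ideal c q)"

definition dan_class ::
  "'a::field poly \<Rightarrow> 'a poly poly \<Rightarrow> 'a poly poly poly \<Rightarrow> 'a poly poly poly set" where
  "dan_class c q p = dan_ideal c q +>\<^bsub>ring_of_type_algebra\<^esub> p"

definition dan_const :: "'a::field poly \<Rightarrow> 'a poly poly \<Rightarrow> 'a \<Rightarrow> 'a poly poly poly set" where
  "dan_const c q a = dan_class c q [:[:[:a:]:]:]"

definition xbar :: "'a::field poly \<Rightarrow> 'a poly poly \<Rightarrow> 'a poly poly poly set" where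
  "xbar c q = dan_class c q [:[:[:0, 1:]:]:]"

definition ybar :: "'a::field poly \<Rightarrow> 'a poly poly \<Rightarrow> 'a poly poly poly set" where
  "ybar c q = dan_class c q [:[:0, 1:]:]"

text \<open>\<open>at_xbar c q p\<close> is $p(\bar x)$.\<close>

definition at_xbar ::
  "'a::field poly \<Rightarrow> 'a poly poly \<Rightarrow> 'a poly \<Rightarrow> 'a poly poly poly set" where
  "at_xbar c q p = dan_class c q [:[:p:]:]"

text \<open>
  Automorphisms are taken as extensional functions on the carrier (\<open>undefined\<close> outside),
  so that equality of functions is equality of automorphisms.
\<close>

definition dan_Aut ::
  "'a::field poly \<Rightarrow> 'a poly poly \<Rightarrow> ('a poly poly poly set \<Rightarrow> 'a poly poly poly set) set" where
  "dan_Aut c q =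
     {\<sigma> \<in> ring_iso (dan_alg c q) (dan_alg c q).
        \<sigma> \<in> extensional (carrier (dan_alg c q)) \<and>
        (\<forall>a. \<sigma> (dan_const c q a) = dan_const c q a)}"

definition dan_Der ::
  "'a::field poly \<Rightarrow> 'a poly poly \<Rightarrow> ('a poly poly poly set \<Rightarrow> 'a poly poly poly set) set" where
  "dan_Der c q = (let A = dan_alg c q in
     {D \<in> carrier A \<rightarrow> carrier A.
        (\<forall>f\<in>carrier A. \<forall>g\<in>carrier A. D (f \<oplus>\<^bsub>A\<^esub> g) = D f \<oplus>\<^bsub>A\<^esub> D g) \<and>
        (\<forall>a. \<forall>f\<in>carrier A. D (dan_const c q a \<otimes>\<^bsub>A\<^esub> f) = dan_const c q a \<otimes>\<^bsub>A\<^esub> D f) \<and>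
        (\<forall>f\<in>carrier A. \<forall>g\<in>carrier A.
           D (f \<otimes>\<^bsub>A\<^esub> g) = (D f \<otimes>\<^bsub>A\<^esub> g) \<oplus>\<^bsub>A\<^esub> (f \<otimes>\<^bsub>A\<^esub> D g))})"

definition simple_der :: "('b, 'm) ring_scheme \<Rightarrow> ('b \<Rightarrow> 'b) \<Rightarrow> bool" where
  "simple_der A D \<longleftrightarrow>
     (\<forall>I. ideal I A \<and> D ` I \<subseteq> I \<longrightarrow> I = {\<zero>\<^bsub>A\<^esub>} \<or> I = carrier A)"

definition dan_Aut_D ::
  "'a::field poly \<Rightarrow> 'a poly poly \<Rightarrow> ('a poly poly poly set \<Rightarrow> 'a poly poly poly set) \<Rightarrow>
   ('a poly poly poly set \<Rightarrow> 'a poly poly poly set) set" where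
  "dan_Aut_D c q D =
     {\<sigma> \<in> dan_Aut c q. \<forall>f\<in>carrier (dan_alg c q). \<sigma> (D f) = D (\<sigma> f)}"

text \<open>\<open>subst_xy e u q\<close> is $q(ex, uy)$.\<close>

definition subst_xy :: "'a::field \<Rightarrow> 'a \<Rightarrow> 'a poly poly \<Rightarrow> 'a poly poly" where
  "subst_xy e u q = pcompose (map_poly (\<lambda>p. pcompose p [:0, e:]) q) [:0, [:u:]:]"

definition dan_G :: "'a::field poly \<Rightarrow> 'a poly poly \<Rightarrow> ('a \<times> 'a) set" where
  "dan_G c q = {(e, u). e \<noteq> 0 \<and> u \<noteq> 0 \<and>
     pcompose c [:0, e:] = smult (e ^ degree c) c \<and>
     subst_xy e u q = smult [:u ^ degree q:] q}"

definition has_weights ::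
  "'a::field poly \<Rightarrow> 'a poly poly \<Rightarrow> ('a poly poly poly set \<Rightarrow> 'a poly poly poly set) \<Rightarrow>
   'a \<times> 'a \<Rightarrow> bool" where
  "has_weights c q \<sigma> = (\<lambda>(e, u). (let A = dan_alg c q in
     (e, u) \<in> dan_G c q \<and>
     \<sigma> (xbar c q) = dan_const c q e \<otimes>\<^bsub>A\<^esub> xbar c q \<and>
     (\<exists>l. \<sigma> (ybar c q) = (dan_const c q u \<otimes>\<^bsub>A\<^esub> ybar c q) \<oplus>\<^bsub>A\<^esub>
                         (at_xbar c q c \<otimes>\<^bsub>A\<^esub> at_xbar c q l))))"

text \<open>
  The canonical homomorphism $\psi$. For an algebra in reduced form with
  $\deg c, \deg_y q \ge 2$ every automorphism has weights, and by
  \<open>has_weights_unique\<close> below only one pair of them. The value \<open>(0, 0)\<close>, which is not in the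
  group $G_{c,q}$, only serves to make the function total.
\<close>

definition dan_psi ::
  "'a::field poly \<Rightarrow> 'a poly poly \<Rightarrow> ('a poly poly poly set \<Rightarrow> 'a poly poly poly set) \<Rightarrow>
   'a \<times> 'a" where
  "dan_psi c q \<sigma> =
     (if \<exists>eu. has_weights c q \<sigma> eu then (THE eu. has_weights c q \<sigma> eu) else (0, 0))"

lemma dan_ideal_ideal: "ideal (dan_ideal c q) ring_of_type_algebra"
proof -
  interpret cring "ring_of_type_algebra :: 'a::field poly poly poly ring"
    by (rule cring_from_type_algebra)
  show "ideal (dan_ideal c q) (ring_of_type_algebra :: 'a poly poly poly ring)"
    unfolding dan_ideal_def by (rule cgenideal_ideal) (simp add: ring_of_type_algebra_def)
qed

lemma dan_class_eq_iff: "dan_class c q p = dan_class c q p' \<longleftrightarrow> dan_rel c q dvd p - p'"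
proof -
  have mem: "x \<in> dan_ideal c q \<longleftrightarrow> dan_rel c q dvd x" for x
    by (auto simp: dan_ideal_def cgenideal_def ring_of_type_algebra_def dvd_def mult.commute)
  have cls: "x \<in> dan_class c q p \<longleftrightarrow> dan_rel c q dvd x - p" for x p
  proof -
    have "x \<in> dan_class c q p \<longleftrightarrow> (\<exists>h\<in>dan_ideal c q. x = h + p)"
      by (auto simp: dan_class_def a_r_coset_def r_coset_def ring_of_type_algebra_def)
    also have "\<dots> \<longleftrightarrow> x - p \<in> dan_ideal c q"
      by (metis add_diff_cancel_right' diff_add_cancel)
    finally show ?thesis by (simp add: mem)
  qed
  show ?thesis
  proof
    assume "dan_class c q p = dan_class c q p'"
    moreover have "p \<in> dan_class c q p" by (simp add: cls)
    ultimately show "dan_rel c q dvd p - p'" by (simp add: cls)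
  next
    assume *: "dan_rel c q dvd p - p'"
    have "dan_rel c q dvd x - p \<longleftrightarrow> dan_rel c q dvd x - p'" for x
      using dvd_add_left_iff[OF *, of "x - p"] by simp
    then show "dan_class c q p = dan_class c q p'" by (auto simp: cls)
  qed
qed

lemma dan_class_mult:
  "dan_class c q p \<otimes>\<^bsub>dan_alg c q\<^esub> dan_class c q p' = dan_class c q (p * p')"
  using ideal.rcoset_mult_add[OF dan_ideal_ideal, of p p' c q]
  by (simp add: dan_class_def dan_alg_def FactRing_def ring_of_type_algebra_def)

lemma dan_class_add:
  "dan_class c q p \<oplus>\<^bsub>dan_alg c q\<^esub> dan_class c q p' = dan_class c q (p + p')"
  using abelian_subgroup.a_rcos_sum
    [OF abelian_subgroupI3[OF ideal.axioms(1)[OF dan_ideal_ideal]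
          ring.is_abelian_group[OF ring_from_type_algebra]], of p p' c q]
  by (simp add: dan_class_def dan_alg_def FactRing_def ring_of_type_algebra_def)

lemma dan_class_xy_inj:
  assumes "c \<noteq> 0" and "dan_class c q [:p:] = dan_class c q [:p':]"
  shows "p = p'"
proof (rule ccontr)
  assume ne: "p \<noteq> p'"
  have "dan_rel c q dvd [:p - p':]" using assms(2) by (simp add: dan_class_eq_iff)
  moreover have "[:p - p':] \<noteq> 0" using ne by simp
  ultimately have "degree (dan_rel c q) \<le> degree [:p - p':]" by (rule dvd_imp_degree_le)
  moreover have "degree (dan_rel c q) = 1" using \<open>c \<noteq> 0\<close> by (simp add: dan_rel_def)
  ultimately show False by simp
qed

lemma has_weights_unique:
  assumes "c \<noteq> 0" and "has_weights c q \<sigma> eu" and "has_weights c q \<sigma> eu'"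
  shows "eu = eu'"
proof -
  obtain e u e' u' where [simp]: "eu = (e, u)" "eu' = (e', u')" by (cases eu; cases eu')
  obtain l where 1: "\<sigma> (xbar c q) = dan_class c q [:[:[:0, e:]:]:]"
      "\<sigma> (ybar c q) = dan_class c q [:[:c * l, [:u:]:]:]"
    using assms(2)
    by (auto simp: has_weights_def Let_def xbar_def ybar_def at_xbar_def dan_const_def
        dan_class_mult dan_class_add)
  obtain l' where 2: "\<sigma> (xbar c q) = dan_class c q [:[:[:0, e':]:]:]"
      "\<sigma> (ybar c q) = dan_class c q [:[:c * l', [:u':]:]:]"
    using assms(3)
    by (auto simp: has_weights_def Let_def xbar_def ybar_def at_xbar_def dan_const_def
        dan_class_mult dan_class_add)
  have "[:[:0, e:]:] = [:[:0, e':]:]" using 1(1) 2(1) by (intro dan_class_xy_inj[OF assms(1), of q]) simp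
  moreover have "[:c * l, [:u:]:] = [:c * l', [:u':]:]"
    using 1(2) 2(2) by (intro dan_class_xy_inj[OF assms(1), of q]) simp
  ultimately show ?thesis by simp
qed

lemma dan_psi_eq: "c \<noteq> 0 \<Longrightarrow> has_weights c q \<sigma> eu \<Longrightarrow> dan_psi c q \<sigma> = eu"
  unfolding dan_psi_def using has_weights_unique by (metis the_equality)

end

theory Submission
  imports Defs
begin

text \<open>
  Let \<open>\<phi>\<close> be an automorphism of $A = A_{c,q}$ commuting with the simple derivation \<open>D\<close>. The
  argument splits according to \<open>\<psi>(\<phi>)\<close>.

  If \<open>\<psi>(\<phi>) \<noteq> (1, 1)\<close>, then \<open>\<phi>\<close> fixes a maximal ideal \<open>m\<close>, and $A/m = k$
  (\<open>residue_is_scalar\<close>), so \<open>\<phi>\<close> induces the identity on $A/m$. The ideal \<open>I\<close> generated by all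
  \<open>\<phi> f - f\<close> is therefore contained in \<open>m\<close>. It is stable under \<open>D\<close> because \<open>D\<close> maps
  \<open>\<phi> f - f\<close> to \<open>\<phi> (D f) - D f\<close>. Simplicity forces \<open>I = 0\<close>, that is, \<open>\<phi> = id\<close>
  (\<open>commuting_endomorphism_fixing_residues_is_identity\<close>).

  If \<open>\<psi>(\<phi>) = (1, 1)\<close>, then \<open>\<phi>\<close> is the shift \<open>x \<mapsto> x\<close>, \<open>y \<mapsto> y + h\<close> with \<open>h = c(x) l(x)\<close>. View $A$
  inside $k(x)[y]$. The elements of $A$ of degree less than \<open>d\<close> in \<open>y\<close>, where \<open>d\<close> is the
  degree of \<open>q\<close> in \<open>y\<close>, are polynomials in \<open>x\<close> and \<open>y\<close> (\<open>low_degree_is_polynomial\<close>): a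
  denominator enters only through \<open>z = q/c\<close>, whose degree in \<open>y\<close> is \<open>d\<close>. Suppose that
  \<open>h \<noteq> 0\<close>. As \<open>D x\<close> is invariant under the shift and the characteristic is zero, \<open>D x\<close> is a
  polynomial \<open>f(x)\<close>. A root \<open>a\<close> of \<open>f\<close> would make the ideal $(x - a)$ stable under \<open>D\<close>, so \<open>f\<close>
  is a nonzero constant \<open>e\<close>. Applying \<open>D\<close> to \<open>\<phi> y - y = h\<close> gives \<open>\<phi>(D y) - D y = e h'\<close>, so
  \<open>D y\<close> is linear in \<open>y\<close>, say \<open>D y = b y + g\<close> with \<open>b\<close> and \<open>g\<close> in $k[x]$ and \<open>b h = e h'\<close>. Thus \<open>h\<close>
  divides its derivative, which is impossible for a polynomial of positive degree
  (\<open>commuting_shift_is_trivial\<close>). Hence \<open>h = 0\<close>, and \<open>\<phi>\<close> is the identity.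
\<close>

section \<open>Endomorphisms commuting with a simple derivation\<close>

text \<open>
  The elements \<open>\<phi> f - f\<close> generate an ideal that is stable under \<open>D\<close>, since \<open>D (\<phi> f - f) =
  \<phi> (D f) - D f\<close>, and that lies in the proper ideal \<open>m\<close>. A simple derivation leaves it no
  choice but to vanish.
\<close>

lemma (in cring) commuting_endomorphism_fixing_residues_is_identity:
  assumes D: "D \<in> carrier R \<rightarrow> carrier R"
      "\<And>f g. f \<in> carrier R \<Longrightarrow> g \<in> carrier R \<Longrightarrow> D (f \<oplus> g) = D f \<oplus> D g"
      "\<And>f g. f \<in> carrier R \<Longrightarrow> g \<in> carrier R \<Longrightarrow> D (f \<otimes> g) = (D f \<otimes> g) \<oplus> (f \<otimes> D g)"
    and simple: "simple_der R D"
    and \<phi>: "\<phi> \<in> ring_hom R R" "\<And>f. f \<in> carrier R \<Longrightarrow> \<phi> (D f) = D (\<phi> f)"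
    and m: "ideal m R" "m \<noteq> carrier R" "\<And>f. f \<in> carrier R \<Longrightarrow> \<phi> f \<ominus> f \<in> m"
    and f: "f \<in> carrier R"
  shows "\<phi> f = f"
proof -
  define S where "S = (\<lambda>f. \<phi> f \<ominus> f) ` carrier R"
  have \<phi>c: "\<phi> g \<in> carrier R" if "g \<in> carrier R" for g
    using ring_hom_closed[OF \<phi>(1) that] .
  have Dc: "D g \<in> carrier R" if "g \<in> carrier R" for g
    using D(1) that by auto
  have S: "S \<subseteq> carrier R"
    by (auto simp: S_def \<phi>c)
  define I where "I = Idl S"
  have I: "ideal I R" unfolding I_def by (rule genideal_ideal[OF S])
  interpret I: ideal I R by (rule I)
  have D0: "D \<zero> = \<zero>"
  proof -
    have "D \<zero> \<oplus> D \<zero> = D \<zero> \<oplus> \<zero>" using D(2)[of \<zero> \<zero>] Dc by simp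
    then show ?thesis using Dc by (meson local.add.l_cancel zero_closed)
  qed
  have Dneg: "D (\<ominus> g) = \<ominus> D g" if "g \<in> carrier R" for g
    using D(2)[of "\<ominus> g" g] D0 that Dc by (simp add: l_neg minus_equality)
  \<comment> \<open>The elements of the ideal which \<open>D\<close> maps back into it form an ideal containing the
      generators.\<close>
  define J where "J = {w \<in> I. D w \<in> I}"
  have J: "ideal J R"
  proof (rule idealI)
    show "subgroup J (add_monoid R)"
    proof (rule local.add.subgroupI)
      show "J \<subseteq> carrier R" unfolding J_def using I.a_subset by blast
      show "J \<noteq> {}"
        using D0 additive_subgroup.zero_closed[OF ideal.axioms(1)[OF I]]
        unfolding J_def by (metis (mono_tags, lifting) empty_iff mem_Collect_eq)
    next
      fix a assume "a \<in> J"
      then show "\<ominus> a \<in> J"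
        using I.a_Hcarr[of a] by (auto simp: J_def Dneg I.a_inv_closed)
    next
      fix a b assume "a \<in> J" "b \<in> J"
      then show "a \<oplus> b \<in> J"
        using I.a_Hcarr additive_subgroup.a_closed[OF ideal.axioms(1)[OF I]]
        by (auto simp: J_def D(2))
    qed
  next
    fix a x assume a: "a \<in> J" and x: "x \<in> carrier R"
    have a': "a \<in> carrier R" "a \<in> I" "D a \<in> I" using a I.a_Hcarr by (auto simp: J_def)
    have "x \<otimes> a \<in> I" using I.I_l_closed x a'(2) by simp
    moreover have "D (x \<otimes> a) \<in> I"
      using a' x Dc by (simp add: D(3) I.I_l_closed I.I_r_closed additive_subgroup.a_closed[OF ideal.axioms(1)[OF I]])
    ultimately show 1: "x \<otimes> a \<in> J" by (simp add: J_def)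
    then show "a \<otimes> x \<in> J" using a' x by (simp add: m_comm)
  qed (rule ring_axioms)
  have "S \<subseteq> J"
  proof
    fix s assume "s \<in> S"
    then obtain g where g: "g \<in> carrier R" and s: "s = \<phi> g \<ominus> g" by (auto simp: S_def)
    have sub: "\<phi> h \<ominus> h \<in> I" if "h \<in> carrier R" for h
      unfolding I_def using genideal_self[OF S] that by (auto simp: S_def)
    have "D s = \<phi> (D g) \<ominus> D g"
      unfolding s using g \<phi>c by (simp add: a_minus_def D(2) Dneg \<phi>(2))
    then show "s \<in> J" using sub[OF g] sub[OF Dc[OF g]] by (simp add: J_def s)
  qed
  then have "I \<subseteq> J" unfolding I_def by (rule genideal_minimal[OF J])
  then have "D ` I \<subseteq> I" by (auto simp: J_def)
  moreover have "I \<subseteq> m" unfolding I_def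
    by (rule genideal_minimal[OF m(1)]) (auto simp: S_def m(3))
  then have "I \<noteq> carrier R" using m(2) ideal.Icarr[OF m(1)] by blast
  ultimately have "I = {\<zero>}" using simple I by (auto simp: simple_der_def)
  then have "\<phi> f \<ominus> f = \<zero>"
    using genideal_self[OF S] f unfolding I_def S_def by blast
  then show ?thesis using f \<phi>c by simp
qed

section \<open>Maximal ideals of an algebra over an algebraically closed field\<close>

text \<open>
  The last axiom is maximality in elementwise form: the quotient by \<open>M\<close> is a field.
\<close>

locale type_maximal_ideal =
  fixes M :: "'b::comm_ring_1 set"
  assumes add: "s \<in> M \<Longrightarrow> t \<in> M \<Longrightarrow> s + t \<in> M"
    and mult: "t \<in> M \<Longrightarrow> s * t \<in> M"
    and one_notin: "1 \<notin> M"
    and inverse_mod: "t \<notin> M \<Longrightarrow> \<exists>w. t * w - 1 \<in> M"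
begin

lemma uminus: "t \<in> M \<Longrightarrow> - t \<in> M"
  using mult[of t "-1"] by simp

lemma diff: "s \<in> M \<Longrightarrow> t \<in> M \<Longrightarrow> s - t \<in> M"
  using add[of s "- t"] uminus by simp

lemma zero: "0 \<in> M"
  using inverse_mod[of 0] uminus one_notin by fastforce

lemma prime:
  assumes "s * t \<in> M"
  shows "s \<in> M \<or> t \<in> M"
proof (rule disjCI)
  assume "t \<notin> M"
  then obtain w where "t * w - 1 \<in> M" using inverse_mod by blast
  then have "w * (s * t) - s * (t * w - 1) \<in> M" using assms diff mult by blast
  then show "s \<in> M" by (simp add: algebra_simps)
qed

end

lemma map_poly_add_hom:
  assumes "\<And>a b. h (a + b) = h a + h b" "h 0 = 0"
  shows "map_poly h (p + p') = map_poly h p + map_poly h p'"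
  by (rule poly_eqI) (simp add: coeff_map_poly assms)

text \<open>
  The map \<open>\<iota>\<close> is the structure map of a $k$-algebra, and \<open>aeval f t\<close> below is $f(t)$ for
  $f \in k[X]$. "The residue of \<open>t\<close> is scalar" means that \<open>t\<close> is congruent modulo \<open>M\<close> to an
  element of $k$.
\<close>

locale algebra_maximal_ideal = type_maximal_ideal M
  for M :: "'b::comm_ring_1 set" +
  fixes \<iota> :: "'a::alg_closed_field \<Rightarrow> 'b"
  assumes \<iota>_add: "\<iota> (a + b) = \<iota> a + \<iota> b"
    and \<iota>_mult: "\<iota> (a * b) = \<iota> a * \<iota> b"
    and \<iota>_1: "\<iota> 1 = 1"
begin

lemma \<iota>_0: "\<iota> 0 = 0"
  using \<iota>_add[of 0 0] by simp

lemma \<iota>_minus: "\<iota> (- a) = - \<iota> a"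
  using \<iota>_add[of "- a" a] by (simp add: \<iota>_0 eq_neg_iff_add_eq_0)

lemma \<iota>_notin: "a \<noteq> 0 \<Longrightarrow> \<iota> a \<notin> M"
  using mult[of "\<iota> a" "\<iota> (inverse a)"] one_notin by (metis \<iota>_1 \<iota>_mult left_inverse)

abbreviation aeval :: "'a poly \<Rightarrow> 'b \<Rightarrow> 'b" where
  "aeval f t \<equiv> poly (map_poly \<iota> f) t"

lemma aeval_pCons: "aeval (pCons a f) t = \<iota> a + t * aeval f t"
  by (simp add: map_poly_pCons \<iota>_0)

lemma aeval_add: "aeval (f + g) t = aeval f t + aeval g t"
  by (simp add: map_poly_add_hom \<iota>_add \<iota>_0)

lemma aeval_smult: "aeval (smult a f) t = \<iota> a * aeval f t"
  by (simp add: map_poly_smult \<iota>_mult \<iota>_0)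

lemma aeval_mult: "aeval (f * g) t = aeval f t * aeval g t"
  by (induction f) (simp_all add: aeval_add aeval_smult aeval_pCons \<iota>_0 algebra_simps)

text \<open>
  The polynomial \<open>f\<close> splits into linear factors, and \<open>M\<close> is prime.
\<close>

lemma algebraic_residue:
  assumes "f \<noteq> 0" "aeval f t \<in> M"
  shows "\<exists>b. t - \<iota> b \<in> M"
  using assms
proof (induction "degree f" arbitrary: f rule: less_induct)
  case less
  show ?case
  proof (cases "degree f = 0")
    case True
    then obtain a where "f = [:a:]" by (metis degree_eq_zeroE)
    then show ?thesis using less.prems \<iota>_notin[of a] by (simp add: aeval_pCons)
  next
    case False
    then obtain b where "poly f b = 0" using alg_closed_imp_poly_has_root by blast
    then obtain g where g: "f = [:-b, 1:] * g" by (metis poly_eq_0_iff_dvd dvdE)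
    have "g \<noteq> 0" using g less.prems by auto
    then have deg: "degree g < degree f" unfolding g by (subst degree_mult_eq) auto
    have "aeval f t = (t - \<iota> b) * aeval g t"
      unfolding g aeval_mult by (simp add: aeval_pCons \<iota>_minus \<iota>_1 map_poly_pCons \<iota>_0)
    then show ?thesis using prime less deg \<open>g \<noteq> 0\<close> by metis
  qed
qed

lemma residue_add:
  assumes "s - aeval f t \<in> M" "s' - aeval f' t \<in> M"
  shows "s + s' - aeval (f + f') t \<in> M"
  using add[OF assms] by (simp add: aeval_add algebra_simps)

lemma residue_mult:
  assumes "s - aeval f t \<in> M" "s' - aeval f' t \<in> M"
  shows "s * s' - aeval (f * f') t \<in> M"
  using add[OF mult[OF assms(1), of s'] mult[OF assms(2), of "aeval f t"]]
  by (simp add: aeval_mult algebra_simps)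

lemma aeval_cong:
  assumes "t - \<iota> d \<in> M"
  shows "aeval f t - \<iota> (poly f d) \<in> M"
proof (induction f)
  case 0
  show ?case by (simp add: \<iota>_0 zero)
next
  case (pCons a f)
  have "t * (aeval f t - \<iota> (poly f d)) + \<iota> (poly f d) * (t - \<iota> d) \<in> M"
    using pCons assms add mult by blast
  then show ?case by (simp add: aeval_pCons \<iota>_add \<iota>_mult algebra_simps)
qed

text \<open>
  If \<open>t\<close> generates the residue field as a $k$-algebra, then its inverse is of the form $f(t)$,
  so that \<open>t\<close> is a root modulo \<open>M\<close> of the nonzero polynomial $X f(X) - 1$.
\<close>

lemma generated_by_one_residue:
  assumes "\<And>w. \<exists>f. w - aeval f t \<in> M"
  shows "\<exists>b. t - \<iota> b \<in> M"
proof (cases "t \<in> M")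
  case True
  then show ?thesis by (intro exI[of _ 0]) (simp add: \<iota>_0)
next
  case False
  then obtain w f where w: "t * w - 1 \<in> M" and f: "w - aeval f t \<in> M"
    using inverse_mod assms by blast
  have "t * w - 1 - t * (w - aeval f t) \<in> M" using w f diff mult by blast
  also have "t * w - 1 - t * (w - aeval f t) = aeval (pCons (-1) f) t"
    by (simp add: aeval_pCons \<iota>_minus \<iota>_1 algebra_simps map_poly_pCons \<iota>_0)
  finally show ?thesis by (intro algebraic_residue) auto
qed

end

section \<open>The Nullstellensatz for the surface $c(x)z = q(x,y)$\<close>

abbreviation konst :: "'a::comm_ring_1 \<Rightarrow> 'a poly poly poly" where
  "konst a \<equiv> [:[:[:a:]:]:]"

abbreviation var_x :: "'a::comm_ring_1 poly poly poly" where "var_x \<equiv> [:[:[:0, 1:]:]:]"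
abbreviation var_y :: "'a::comm_ring_1 poly poly poly" where "var_y \<equiv> [:[:0, 1:]:]"
abbreviation var_z :: "'a::comm_ring_1 poly poly poly" where "var_z \<equiv> [:0, 1:]"

lemma polynomial_x_induct:
  fixes f :: "'a::comm_ring_1 poly"
  assumes "\<And>s t. P s \<Longrightarrow> P t \<Longrightarrow> P (s + t)" "\<And>s t. P s \<Longrightarrow> P t \<Longrightarrow> P (s * t)"
    "\<And>a. P (konst a)" "P var_x"
  shows "P [:[:f:]:]"
proof (induction f)
  case 0
  then show ?case using assms(3)[of 0] by simp
next
  case (pCons a f)
  have eq: "[:[:pCons a f:]:] = konst a + var_x * [:[:f:]:]" by simp
  show ?case unfolding eq by (intro assms(1)[OF assms(3) assms(2)[OF assms(4) pCons.IH]])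
qed

lemma polynomial_xy_induct:
  fixes p :: "'a::comm_ring_1 poly poly"
  assumes "\<And>s t. P s \<Longrightarrow> P t \<Longrightarrow> P (s + t)" "\<And>s t. P s \<Longrightarrow> P t \<Longrightarrow> P (s * t)"
    "\<And>a. P (konst a)" "P var_x" "P var_y"
  shows "P [:p:]"
proof (induction p)
  case 0
  then show ?case using assms(3)[of 0] by simp
next
  case (pCons f p)
  have eq: "[:pCons f p:] = [:[:f:]:] + var_y * [:p:]" by simp
  have "P [:[:f:]:]" by (rule polynomial_x_induct) (fact assms)+
  then show ?case unfolding eq by (rule assms(1)[OF _ assms(2)[OF assms(5) pCons.IH]])
qed

lemma polynomial_xyz_induct:
  fixes t :: "'a::comm_ring_1 poly poly poly"
  assumes "\<And>s t. P s \<Longrightarrow> P t \<Longrightarrow> P (s + t)" "\<And>s t. P s \<Longrightarrow> P t \<Longrightarrow> P (s * t)"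
    "\<And>a. P (konst a)" "P var_x" "P var_y" "P var_z"
  shows "P t"
proof (induction t)
  case 0
  then show ?case using assms(3)[of 0] by simp
next
  case (pCons p t)
  have eq: "pCons p t = [:p:] + var_z * t" by simp
  have "P [:p:]" by (rule polynomial_xy_induct) (fact assms)+
  then show ?case unfolding eq by (rule assms(1)[OF _ assms(2)[OF assms(6) pCons.IH]])
qed

lemma lead_coeff_quasi_monic:
  assumes "quasi_monic q"
  obtains r where "r \<noteq> 0" "lead_coeff q = [:r:]"
  using assms by (auto simp: quasi_monic_def)

text \<open>
  Modulo the relation, \<open>c z\<close> can be replaced by \<open>q\<close>.
\<close>

lemma clear_denominators:
  fixes t :: "'a::field poly poly poly"
  shows "\<exists>n p. dan_rel c q dvd [:[:c ^ n:]:] * t - [:p:]"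
proof (induction t)
  case 0
  show ?case by (rule exI[of _ 0], rule exI[of _ 0]) simp
next
  case (pCons r t)
  then obtain n p where np: "dan_rel c q dvd [:[:c ^ n:]:] * t - [:p:]" by blast
  have "[:[:c ^ Suc n:]:] * pCons r t - [:[:c ^ Suc n:] * r + q * p:] =
      [:[:c:]:] * var_z * ([:[:c ^ n:]:] * t - [:p:]) + dan_rel c q * [:p:]"
    by (simp add: dan_rel_def algebra_simps smult_add_right)
  then show ?case using np by (metis dvd_add dvd_mult dvd_triv_left)
qed

lemma poly_poly_eq: "poly (map_poly (\<lambda>f. poly f a) p) b = poly (poly p [:b:]) (a::'a::comm_ring_1)"
  by (induction p) (simp_all add: map_poly_pCons)

text \<open>
  A nonzero ideal \<open>P\<close> of $k[x][y]$ that meets $k[x]$ only in zero is generated over $k(x)$ by an element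
  \<open>g\<close> of least degree in \<open>y\<close>. Pseudo-division by \<open>g\<close> uses no denominators but powers of the
  leading coefficient of \<open>g\<close>. Hence, if \<open>a\<close> is not a root of this coefficient, each root \<open>b\<close> of
  $g(a, y)$ gives a common zero of \<open>P\<close>. All but finitely many \<open>a\<close> qualify, so \<open>a\<close> can also
  avoid the roots of \<open>c\<close>.
\<close>

lemma zero_of_ideal_meeting_constants_trivially:
  fixes P :: "'a::{alg_closed_field,field_char_0} poly poly set"
  assumes sub: "\<And>p p'. p \<in> P \<Longrightarrow> p' \<in> P \<Longrightarrow> p - p' \<in> P"
    and mult: "\<And>p p'. p \<in> P \<Longrightarrow> p' * p \<in> P"
    and const: "\<And>f. [:f:] \<in> P \<Longrightarrow> f = 0"
    and c: "c \<noteq> (0 :: 'a poly)"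
  shows "\<exists>a b. poly c a \<noteq> 0 \<and> (\<forall>p\<in>P. poly (poly p [:b:]) a = 0)"
proof (cases "P \<subseteq> {0}")
  case True
  have "finite {a. poly c a = 0}" using poly_roots_finite[OF c] .
  then obtain a where "poly c a \<noteq> 0" using ex_new_if_finite[OF infinite_UNIV_char_0] by blast
  then show ?thesis using True by (intro exI[of _ a] exI[of _ 0]) auto
next
  case False
  then obtain p0 where "p0 \<in> P \<and> p0 \<noteq> 0" by blast
  then obtain g where g: "g \<in> P" "g \<noteq> 0" and
    min: "\<And>p. p \<in> P \<Longrightarrow> p \<noteq> 0 \<Longrightarrow> degree g \<le> degree p"
    using ex_has_least_nat[of "\<lambda>p. p \<in> P \<and> p \<noteq> 0" p0 degree] by blast
  have dg: "degree g \<noteq> 0"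
    using const g by (metis degree_eq_zeroE pCons_0_0)
  have "finite {a. poly (c * lead_coeff g) a = 0}"
    using c g(2) by (intro poly_roots_finite) auto
  then obtain a where a: "poly (c * lead_coeff g) a \<noteq> 0"
    using ex_new_if_finite[OF infinite_UNIV_char_0] by blast
  define ga where "ga = map_poly (\<lambda>f. poly f a) g"
  have "coeff ga (degree g) \<noteq> 0" using a by (simp add: ga_def coeff_map_poly)
  then have "degree ga > 0" using dg le_degree[of ga "degree g"] by auto
  then obtain b where "poly ga b = 0" using alg_closed_imp_poly_has_root by blast
  then have b: "poly (poly g [:b:]) a = 0" by (simp add: ga_def poly_poly_eq)
  have "poly (poly p [:b:]) a = 0" if p: "p \<in> P" for p
  proof -
    obtain s r where sr: "pseudo_divmod p g = (s, r)" by fastforce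
    define n where "n = Suc (degree p) - degree g"
    have eq: "smult (lead_coeff g ^ n) p = g * s + r"
      using pseudo_divmod(1)[OF g(2) sr] by (simp add: n_def)
    have "r = [:lead_coeff g ^ n:] * p - s * g" using eq by (simp add: algebra_simps)
    then have "r \<in> P" using sub mult p g(1) by blast
    then have "r = 0" using pseudo_divmod(2)[OF g(2) sr] min by force
    then have "poly (poly (smult (lead_coeff g ^ n) p) [:b:]) a = 0" using eq b by simp
    then show ?thesis using a by simp
  qed
  then show ?thesis using a by (intro exI[of _ a] exI[of _ b]) auto
qed

lemma poly_of_X_minus_const: "[:[:f:]:] - konst (poly f a) = [:[:synthetic_div f a:]:] * (var_x - konst a)"
proof -
  have "f - [:poly f a:] = synthetic_div f a * [:-a, 1:]"
    using synthetic_div_correct'[of a f] by (simp add: algebra_simps)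
  then show ?thesis by simp
qed

locale surface_maximal_ideal =
  algebra_maximal_ideal M konst
  for M :: "'a::{alg_closed_field,field_char_0} poly poly poly set" +
  fixes c :: "'a poly" and q :: "'a poly poly"
  assumes c: "c \<noteq> 0" and q: "quasi_monic q" "degree q > 0" and rel: "dan_rel c q \<in> M"
begin

text \<open>
  Otherwise $k[x]$ meets \<open>M\<close> only in zero. Let $(a, b)$ be a common zero of $M \cap k[x,y]$ with
  $c(a) \neq 0$. The element $x - a$ has an inverse modulo \<open>M\<close>, and clearing denominators gives
  a polynomial $p(x,y)$ such that $(x - a)p - c^n$ lies in \<open>M\<close>. Its value at $(a, b)$ is
  $-c(a)^n \neq 0$.
\<close>

lemma x_residue: "\<exists>a. var_x - konst a \<in> M"
proof (rule ccontr)
  assume none: "\<not> ?thesis"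
  have aevX: "aeval f var_x = [:[:f:]:]" for f
    by (induction f) (simp_all add: aeval_pCons map_poly_pCons)
  have const: "f = 0" if "[:[:f:]:] \<in> M" for f
    using algebraic_residue[of f var_x] that none by (auto simp: aevX)
  define P where "P = {p. [:p:] \<in> M}"
  have "\<exists>a b. poly c a \<noteq> 0 \<and> (\<forall>p\<in>P. poly (poly p [:b:]) a = 0)"
  proof (rule zero_of_ideal_meeting_constants_trivially[OF _ _ _ c])
    show "p - p' \<in> P" if "p \<in> P" "p' \<in> P" for p p'
      using diff[of "[:p:]" "[:p':]"] that by (simp add: P_def)
    show "p' * p \<in> P" if "p \<in> P" for p p'
      using mult[of "[:p:]" "[:p':]"] that by (simp add: P_def mult.commute)
    show "f = 0" if "[:f:] \<in> P" for f
      using const that by (simp add: P_def)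
  qed
  then obtain a b where a: "poly c a \<noteq> 0"
    and zero: "\<And>p. [:p:] \<in> M \<Longrightarrow> poly (poly p [:b:]) a = 0"
    by (auto simp: P_def)
  have "var_x - konst a \<notin> M" using none by blast
  then obtain w where w: "(var_x - konst a) * w - 1 \<in> M" using inverse_mod by blast
  obtain n p where np: "dan_rel c q dvd [:[:c ^ n:]:] * w - [:p:]"
    using clear_denominators by blast
  then have "[:[:c ^ n:]:] * w - [:p:] \<in> M" using rel mult by (metis dvdE mult.commute)
  then have "[:[:c ^ n:]:] * ((var_x - konst a) * w - 1) -
      (var_x - konst a) * ([:[:c ^ n:]:] * w - [:p:]) \<in> M"
    using w mult diff by blast
  also have "[:[:c ^ n:]:] * ((var_x - konst a) * w - 1) -
      (var_x - konst a) * ([:[:c ^ n:]:] * w - [:p:]) = (var_x - konst a) * [:p:] - [:[:c ^ n:]:]"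
    by (simp only: algebra_simps mult_1_right mult_1_left)
  also have "\<dots> = [:[:[:-a, 1:]:] * p - [:c ^ n:]:]" by simp
  finally have "poly (poly ([:[:-a, 1:]:] * p - [:c ^ n:]) [:b:]) a = 0" by (rule zero)
  then show False using a by simp
qed

text \<open>
  Let \<open>x\<close> be congruent to \<open>a\<close>. If $c(a) = 0$, the relation becomes the equation $q(a, y) = 0$ for
  \<open>y\<close>, which is not trivial as \<open>q\<close> is quasi-monic. If $c(a) \neq 0$, then \<open>z\<close> is congruent to
  $q(a, y)/c(a)$, so that \<open>y\<close> alone generates the residue field.
\<close>

lemma y_residue: "\<exists>b. var_y - konst b \<in> M"
proof -
  obtain a where a: "var_x - konst a \<in> M" using x_residue by blast
  have fa: "[:[:f:]:] - konst (poly f a) \<in> M" for f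
    unfolding poly_of_X_minus_const by (rule mult[OF a])
  have aY: "[:p:] - aeval (map_poly (\<lambda>f. poly f a) p) var_y \<in> M" for p
  proof (induction p)
    case 0
    show ?case using zero by simp
  next
    case (pCons f p)
    have eq: "[:pCons f p:] - aeval (map_poly (\<lambda>f. poly f a) (pCons f p)) var_y =
      ([:[:f:]:] - konst (poly f a)) + var_y * ([:p:] - aeval (map_poly (\<lambda>f. poly f a) p) var_y)"
      by (simp add: map_poly_pCons algebra_simps)
    show ?case unfolding eq by (intro add mult fa pCons.IH)
  qed
  show ?thesis
  proof (cases "poly c a = 0")
    case True
    define qa where "qa = map_poly (\<lambda>f. poly f a) q"
    obtain r where "r \<noteq> 0" "lead_coeff q = [:r:]" using lead_coeff_quasi_monic[OF q(1)] .
    then have "coeff qa (degree q) \<noteq> 0" by (simp add: qa_def coeff_map_poly)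
    then have "qa \<noteq> 0" by auto
    moreover have "aeval qa var_y \<in> M"
    proof -
      have "[:[:c:]:] \<in> M" using fa[of c] True by simp
      then have "var_z * [:[:c:]:] - dan_rel c q - ([:q:] - aeval qa var_y) \<in> M"
        using rel aY[of q] mult diff by (simp only: qa_def)
      then show ?thesis by (simp add: dan_rel_def)
    qed
    ultimately show ?thesis by (rule algebraic_residue)
  next
    case False
    define s where "s = konst (inverse (poly c a))"
    have s: "s * konst (poly c a) = 1" using False by (simp add: s_def one_pCons)
    have "\<exists>f. t - aeval f var_y \<in> M" for t
    proof (induction t rule: polynomial_xyz_induct)
      case (1 t t')
      then obtain f f' where "t - aeval f var_y \<in> M" "t' - aeval f' var_y \<in> M" by blast
      then show ?case using residue_add by blast
    next
      case (2 t t')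
      then obtain f f' where "t - aeval f var_y \<in> M" "t' - aeval f' var_y \<in> M" by blast
      then show ?case using residue_mult by blast
    next
      case (3 b)
      show ?case by (rule exI[of _ "[:b:]"]) (use zero in \<open>simp add: map_poly_pCons\<close>)
    next
      case 4
      show ?case by (rule exI[of _ "[:a:]"]) (use a in \<open>simp add: map_poly_pCons\<close>)
    next
      case 5
      show ?case
        by (rule exI[of _ "[:0, 1:]"]) (use zero in \<open>simp add: map_poly_pCons flip: one_pCons\<close>)
    next
      case 6
      define qa where "qa = map_poly (\<lambda>f. poly f a) q"
      have "s * (dan_rel c q - var_z * ([:[:c:]:] - konst (poly c a)) + ([:q:] - aeval qa var_y)) \<in> M"
        using rel aY[of q] fa[of c] mult diff add by (simp only: qa_def)
      also have "s * (dan_rel c q - var_z * ([:[:c:]:] - konst (poly c a)) + ([:q:] - aeval qa var_y)) =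
        (s * konst (poly c a)) * var_z - s * aeval qa var_y"
        by (simp only: dan_rel_def algebra_simps)
      also have "\<dots> = var_z - aeval (smult (inverse (poly c a)) qa) var_y"
        by (simp only: s aeval_smult) (simp add: s_def)
      finally show ?case by blast
    qed
    then show ?thesis by (rule generated_by_one_residue)
  qed
qed

text \<open>
  Once the residues of \<open>x\<close> and \<open>y\<close> are scalars, \<open>z\<close> alone generates the residue field.
\<close>

lemma residue_is_scalar: "\<exists>a. t - konst a \<in> M"
proof -
  obtain a b where a: "var_x - konst a \<in> M" and b: "var_y - konst b \<in> M"
    using x_residue y_residue by blast
  have cong: "\<exists>f. t - aeval f var_z \<in> M" for t
  proof (induction t rule: polynomial_xyz_induct)
    case (1 t t')
    then show ?case using residue_add by blast
  next
    case (2 t t')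
    then show ?case using residue_mult by blast
  next
    case (3 b)
    show ?case by (rule exI[of _ "[:b:]"]) (use zero in \<open>simp add: map_poly_pCons\<close>)
  next
    case 4
    show ?case by (rule exI[of _ "[:a:]"]) (use a in \<open>simp add: map_poly_pCons\<close>)
  next
    case 5
    show ?case by (rule exI[of _ "[:b:]"]) (use b in \<open>simp add: map_poly_pCons\<close>)
  next
    case 6
    show ?case
      by (rule exI[of _ "[:0, 1:]"]) (use zero in \<open>simp add: map_poly_pCons flip: one_pCons\<close>)
  qed
  obtain d where d: "var_z - konst d \<in> M" using generated_by_one_residue[OF cong] by blast
  obtain f where "t - aeval f var_z \<in> M" using cong by blast
  then have "(t - aeval f var_z) + (aeval f var_z - konst (poly f d)) \<in> M"
    using aeval_cong[OF d] add by blast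
  then have "t - konst (poly f d) \<in> M"
    by (simp only: diff_add_cancel add_diff_eq)
  then show ?thesis by blast
qed

end

section \<open>Elements of low degree in \<open>y\<close>\<close>

text \<open>
  Modulo \<open>c\<close> the leading coefficient of \<open>q\<close> is still a unit, so a nonzero multiple of \<open>q\<close> has at
  least the degree of \<open>q\<close>; the congruence of \<open>p\<close> and \<open>q s\<close> thus forces both to vanish. The proof reads off the top coefficient of the
  product and removes the leading term of \<open>s\<close>.
\<close>

lemma const_dvd_of_dvd_quasi_monic_combination:
  fixes c :: "'a::field poly"
  assumes q: "quasi_monic q" and p: "degree p < degree q" and dvd: "[:c:] dvd p - q * s"
  shows "[:c:] dvd s" "[:c:] dvd p"
proof -
  obtain r where r: "r \<noteq> 0" "lead_coeff q = [:r:]" using lead_coeff_quasi_monic[OF q] .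
  have q0: "q \<noteq> 0" using p by auto
  have "[:c:] dvd s" using dvd
  proof (induction "degree s" arbitrary: s rule: less_induct)
    case less
    show ?case
    proof (cases "s = 0")
      case False
      have "c dvd coeff (p - q * s) (degree q + degree s)" using less.prems by (simp add: const_poly_dvd_iff)
      moreover have "coeff p (degree q + degree s) = 0" using p by (intro coeff_eq_0) simp
      ultimately have "c dvd smult r (lead_coeff s)"
        using coeff_mult_degree_sum[of q s] r(2) by simp
      then have lc: "c dvd lead_coeff s" using r(1) by (simp add: dvd_smult_iff)
      define s' where "s' = s - monom (lead_coeff s) (degree s)"
      have m: "[:c:] dvd monom (lead_coeff s) (degree s)" using lc by (simp add: const_poly_dvd_iff coeff_monom)
      have "p - q * s' = (p - q * s) + q * monom (lead_coeff s) (degree s)" by (simp add: s'_def algebra_simps)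
      then have d: "[:c:] dvd p - q * s'" using less.prems m by (simp only: dvd_add dvd_mult)
      have "[:c:] dvd s'"
      proof (cases "degree s = 0")
        case True
        then obtain a where "s = [:a:]" by (rule degree_eq_zeroE)
        then have "s' = 0" by (simp add: s'_def monom_0)
        then show ?thesis by simp
      next
        case False
        have "degree s' < degree s"
        proof (rule degree_lessI)
          show "\<forall>k\<ge>degree s. coeff s' k = 0"
            by (auto simp: s'_def coeff_monom coeff_eq_0)
        qed (use False in simp)
        then show ?thesis using less.hyps d by blast
      qed
      then have "[:c:] dvd s' + monom (lead_coeff s) (degree s)" using m by (rule dvd_add)
      then show ?thesis by (simp add: s'_def)
    qed simp
  qed
  then show "[:c:] dvd s" .
  then have "[:c:] dvd (p - q * s) + q * s" using dvd by (intro dvd_add dvd_mult)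
  then show "[:c:] dvd p" by simp
qed

text \<open>
  In other words, \<open>c\<close> is not a zero divisor in $A_{c,q}$: if \<open>c t = (c z - q) s\<close>, then \<open>c\<close>
  divides \<open>q s\<close>, hence \<open>s\<close>.
\<close>

lemma dan_rel_cancel_const:
  assumes c: "c \<noteq> (0 :: 'a::field poly)" and q: "quasi_monic q" "degree q > 0"
    and dvd: "dan_rel c q dvd [:[:c:]:] * t"
  shows "dan_rel c q dvd t"
proof -
  obtain s where s: "[:[:c:]:] * t = dan_rel c q * s" using dvd by (rule dvdE)
  have "[:[:c:]:] dvd s"
  proof (subst const_poly_dvd_iff, rule allI)
    fix n
    have "[:q:] * s = [:[:c:]:] * ([:0, 1:] * s) - dan_rel c q * s"
      unfolding dan_rel_def by (simp only: left_diff_distrib mult.assoc diff_diff_eq2 add_diff_cancel_left')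
    also have "\<dots> = [:[:c:]:] * ([:0, 1:] * s - t)"
      unfolding s[symmetric] by (simp only: right_diff_distrib)
    finally have "coeff ([:q:] * s) n = coeff ([:[:c:]:] * ([:0, 1:] * s - t)) n" by (simp only:)
    then have e: "q * coeff s n = [:c:] * coeff ([:0, 1:] * s - t) n"
      by (simp only: mult_pCons_left mult_zero_left coeff_smult coeff_add pCons_0_0 coeff_0 add_0_right)
    have "0 - q * coeff s n = [:c:] * - coeff ([:0, 1:] * s - t) n"
      unfolding e by (simp only: diff_0 mult_minus_right)
    then have d: "[:c:] dvd 0 - q * coeff s n" by (rule dvdI)
    show "[:c:] dvd coeff s n"
      by (rule const_dvd_of_dvd_quasi_monic_combination(1)[OF q(1) _ d]) (use q(2) in simp)
  qed
  then obtain s' where s': "s = [:[:c:]:] * s'" by (rule dvdE)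
  have "[:[:c:]:] * t = [:[:c:]:] * (dan_rel c q * s')" unfolding s s' by (rule mult.left_commute)
  moreover have "[:[:c:]:] \<noteq> 0" using c by simp
  ultimately have "t = dan_rel c q * s'" using mult_left_cancel by blast
  then show ?thesis by (rule dvdI)
qed

lemma dan_rel_cancel_const_power:
  assumes c: "c \<noteq> (0 :: 'a::field poly)" and q: "quasi_monic q" "degree q > 0"
    and dvd: "dan_rel c q dvd [:[:c ^ n:]:] * t"
  shows "dan_rel c q dvd t"
  using dvd
proof (induction n)
  case (Suc n)
  have "[:[:c ^ Suc n:]:] * t = [:[:c:]:] * ([:[:c ^ n:]:] * t)" by simp
  then have "dan_rel c q dvd [:[:c:]:] * ([:[:c ^ n:]:] * t)" using Suc.prems by (simp only:)
  then show ?case by (rule Suc.IH[OF dan_rel_cancel_const[OF c q]])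
qed (simp flip: one_pCons)

text \<open>
  The fraction \<open>p / c ^ n\<close> of low degree in \<open>y\<close> lies in $A_{c,q}$ only if it lies in $k[x,y]$.
  For \<open>n > 0\<close>, write \<open>c ^ n t - p = (c z - q) s\<close>; in degree 0 in \<open>z\<close> this says that \<open>c\<close> divides
  $p - q s_0$, hence \<open>p\<close>, and a factor \<open>c\<close> can be cancelled.
\<close>

lemma low_degree_is_polynomial:
  assumes c: "c \<noteq> (0 :: 'a::field poly)" and q: "quasi_monic q" and p: "degree p < degree q"
    and dvd: "dan_rel c q dvd [:[:c ^ n:]:] * t - [:p:]"
  shows "\<exists>p'. degree p' \<le> degree p \<and> dan_rel c q dvd t - [:p':]"
  using p dvd
proof (induction n arbitrary: p)
  case 0
  then show ?case by (intro exI[of _ p]) (simp flip: one_pCons)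
next
  case (Suc n)
  have q0: "degree q > 0" using Suc.prems by simp
  obtain s where s: "[:[:c ^ Suc n:]:] * t - [:p:] = dan_rel c q * s"
    using Suc.prems by (auto elim: dvdE)
  have "coeff ([:[:c ^ Suc n:]:] * t - [:p:]) 0 = coeff (dan_rel c q * s) 0" by (simp only: s)
  then have "p - q * coeff s 0 = [:c:] * ([:c ^ n:] * coeff t 0)"
    by (simp add: dan_rel_def algebra_simps)
  then have "[:c:] dvd p - q * coeff s 0" by (metis dvd_triv_left)
  then have "[:c:] dvd p" using const_dvd_of_dvd_quasi_monic_combination(2)[OF q Suc.prems(1)] by blast
  then obtain p1 where p1: "p = [:c:] * p1" by (auto elim: dvdE)
  have deg: "degree p1 = degree p" using p1 c by simp
  have eq: "[:[:c ^ Suc n:]:] * t - [:p:] = [:[:c:]:] * ([:[:c ^ n:]:] * t - [:p1:])"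
    by (simp add: p1 algebra_simps smult_diff_right)
  have "dan_rel c q dvd [:[:c ^ n:]:] * t - [:p1:]"
    by (rule dan_rel_cancel_const[OF c q q0 Suc.prems(2)[unfolded eq]])
  then show ?case using Suc.IH[of p1] Suc.prems(1) unfolding deg by blast
qed

section \<open>Polynomials changed by a constant under a shift\<close>

text \<open>
  Iterating $p(y + h) = p(y) + g$ gives $p(kh) = p(0) + kg$ for all natural numbers \<open>k\<close>. Hence
  $h p(y)$ agrees with $h p(0) + g y$ at infinitely many points.
\<close>

lemma shift_difference_const:
  fixes p :: "'a::{idom,ring_char_0} poly"
  assumes h: "h \<noteq> 0" and eq: "pcompose p [:h, 1:] = p + [:g:]"
  shows "smult h p = [:h * coeff p 0, g:]"
proof -
  have val: "poly p (of_nat k * h) = coeff p 0 + of_nat k * g" for k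
  proof (induction k)
    case 0
    then show ?case by (simp add: poly_0_coeff_0)
  next
    case (Suc k)
    have "poly (pcompose p [:h, 1:]) (of_nat k * h) = poly (p + [:g:]) (of_nat k * h)"
      using eq by simp
    then show ?case using Suc by (simp add: poly_pcompose algebra_simps)
  qed
  define w where "w = smult h p - [:h * coeff p 0, g:]"
  have "poly w (of_nat k * h) = 0" for k
    unfolding w_def poly_diff poly_smult val by (simp add: algebra_simps)
  then have "range (\<lambda>k::nat. of_nat k * h) \<subseteq> {x. poly w x = 0}"
    by auto
  moreover have "infinite (range (\<lambda>k::nat. of_nat k * h))"
    using h by (intro range_inj_infinite) (auto simp: inj_def)
  ultimately have "w = 0" using poly_roots_finite infinite_super by blast
  then show ?thesis by (simp add: w_def)
qed

section \<open>Calculus of classes in $A_{c,q}$\<close>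

lemma carrier_dan_alg: "carrier (dan_alg c q) = range (dan_class c q)"
  by (auto simp: dan_alg_def FactRing_def A_RCOSETS_def' dan_class_def ring_of_type_algebra_def)

lemma dan_alg_cring: "cring (dan_alg c q)"
  unfolding dan_alg_def
  by (rule ideal.quotient_is_cring[OF dan_ideal_ideal cring_from_type_algebra])

lemma dan_one: "\<one>\<^bsub>dan_alg c q\<^esub> = dan_class c q 1"
  by (simp add: dan_alg_def FactRing_def dan_class_def) (simp add: ring_of_type_algebra_def)

lemma dan_zero: "\<zero>\<^bsub>dan_alg c q\<^esub> = dan_class c q 0"
proof -
  interpret cring "dan_alg c q" by (rule dan_alg_cring)
  have "dan_class c q 0 \<oplus>\<^bsub>dan_alg c q\<^esub> dan_class c q 0 = dan_class c q 0"
    by (simp add: dan_class_add)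
  moreover have "dan_class c q 0 \<in> carrier (dan_alg c q)" by (simp add: carrier_dan_alg)
  ultimately show ?thesis by (metis add.r_cancel_one)
qed

lemma dan_uminus: "\<ominus>\<^bsub>dan_alg c q\<^esub> dan_class c q t = dan_class c q (- t)"
proof -
  interpret cring "dan_alg c q" by (rule dan_alg_cring)
  show ?thesis
    by (rule minus_equality) (auto simp: dan_class_add dan_zero carrier_dan_alg)
qed

lemma dan_minus:
  "dan_class c q s \<ominus>\<^bsub>dan_alg c q\<^esub> dan_class c q t = dan_class c q (s - t)"
  by (simp add: a_minus_def dan_uminus dan_class_add)

text \<open>
  The Nullstellensatz above takes place in $k[x,y,z]$, where a maximal ideal of the quotient is
  represented by its preimage.
\<close>

lemma maximalideal_preimage:
  fixes c :: "'a::{alg_closed_field,field_char_0} poly"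
  assumes m: "maximalideal m (dan_alg c q)" and c: "c \<noteq> 0" and q: "quasi_monic q" "degree q > 0"
  shows "surface_maximal_ideal {t. dan_class c q t \<in> m} c q"
proof -
  interpret cring "dan_alg c q" by (rule dan_alg_cring)
  interpret m: maximalideal m "dan_alg c q" by (rule m)
  have car: "dan_class c q t \<in> carrier (dan_alg c q)" for t by (simp add: carrier_dan_alg)
  interpret F: field "dan_alg c q Quot m"
    by (rule m.quotient_is_field[OF dan_alg_cring])
  show ?thesis
  proof
    fix s t assume "s \<in> {t. dan_class c q t \<in> m}" "t \<in> {t. dan_class c q t \<in> m}"
    then show "s + t \<in> {t. dan_class c q t \<in> m}"
      using additive_subgroup.a_closed[OF ideal.axioms(1)[OF m.ideal_axioms]]
      by (simp flip: dan_class_add)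
  next
    fix s t assume "t \<in> {t. dan_class c q t \<in> m}"
    then show "s * t \<in> {t. dan_class c q t \<in> m}"
      using m.I_l_closed[OF _ car] by (simp flip: dan_class_mult)
  next
    show "1 \<notin> {t. dan_class c q t \<in> m}"
      using m.one_imp_carrier m.I_notcarr by (auto simp: dan_one)
  next
    fix t assume t: "t \<notin> {t. dan_class c q t \<in> m}"
    \<comment> \<open>By maximality, \<open>m\<close> and the class of \<open>t\<close> together generate the unit ideal.\<close>
    define J where "J = m <+>\<^bsub>dan_alg c q\<^esub> (PIdl\<^bsub>dan_alg c q\<^esub> (dan_class c q t))"
    have P: "ideal (PIdl\<^bsub>dan_alg c q\<^esub> (dan_class c q t)) (dan_alg c q)"
      by (rule cgenideal_ideal[OF car])
    have J: "ideal J (dan_alg c q)" unfolding J_def by (rule add_ideals[OF m.ideal_axioms P])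
    have memJ: "x \<in> J \<longleftrightarrow> (\<exists>i\<in>m. \<exists>y\<in>carrier (dan_alg c q).
        x = i \<oplus>\<^bsub>dan_alg c q\<^esub> (y \<otimes>\<^bsub>dan_alg c q\<^esub> dan_class c q t))" for x
      by (auto simp: J_def set_add_def' cgenideal_def)
    have m0: "\<zero>\<^bsub>dan_alg c q\<^esub> \<in> m"
      by (rule additive_subgroup.zero_closed[OF ideal.axioms(1)[OF m.ideal_axioms]])
    have "m \<subseteq> J"
    proof
      fix i assume i: "i \<in> m"
      then have "i = i \<oplus>\<^bsub>dan_alg c q\<^esub> (\<zero>\<^bsub>dan_alg c q\<^esub> \<otimes>\<^bsub>dan_alg c q\<^esub> dan_class c q t)"
        using car m.a_Hcarr by simp
      then show "i \<in> J" using i memJ by blast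
    qed
    moreover have "dan_class c q t \<in> J"
    proof -
      have "dan_class c q t = \<zero>\<^bsub>dan_alg c q\<^esub> \<oplus>\<^bsub>dan_alg c q\<^esub>
          (\<one>\<^bsub>dan_alg c q\<^esub> \<otimes>\<^bsub>dan_alg c q\<^esub> dan_class c q t)"
        using car by simp
      then show ?thesis using m0 memJ by blast
    qed
    moreover have "J \<subseteq> carrier (dan_alg c q)" using ideal.Icarr[OF J] by blast
    ultimately have "J = carrier (dan_alg c q)"
      using m.I_maximal[OF J] t by blast
    then have "\<one>\<^bsub>dan_alg c q\<^esub> \<in> J" by simp
    then obtain i y where i: "i \<in> m" and "y \<in> carrier (dan_alg c q)"
      and eq: "\<one>\<^bsub>dan_alg c q\<^esub> = i \<oplus>\<^bsub>dan_alg c q\<^esub> (y \<otimes>\<^bsub>dan_alg c q\<^esub> dan_class c q t)"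
      using memJ by blast
    then obtain w j where w: "y = dan_class c q w" and j: "i = dan_class c q j"
      using m.Icarr[OF i] unfolding carrier_dan_alg by blast
    have "dan_class c q (1 - t * w) = dan_class c q j"
    proof -
      have "dan_class c q 1 = dan_class c q (j + t * w)"
        using eq by (simp add: w j dan_one dan_class_add dan_class_mult mult.commute)
      then show ?thesis by (simp add: dan_class_eq_iff algebra_simps)
    qed
    then have "dan_class c q (1 - t * w) \<in> m" using i j by simp
    then have "dan_class c q (-1) \<otimes>\<^bsub>dan_alg c q\<^esub> dan_class c q (1 - t * w) \<in> m"
      using m.I_l_closed[OF _ car] by simp
    then show "\<exists>w. t * w - 1 \<in> {t. dan_class c q t \<in> m}"
      by (auto simp: dan_class_mult)
  next
    have "dan_class c q (dan_rel c q) = \<zero>\<^bsub>dan_alg c q\<^esub>"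
      by (simp add: dan_zero dan_class_eq_iff)
    then show "dan_rel c q \<in> {t. dan_class c q t \<in> m}"
      using additive_subgroup.zero_closed[OF ideal.axioms(1)[OF m.ideal_axioms]] by simp
  next
    show "konst (a + b) = konst a + konst b" for a b :: 'a by simp
    show "konst (a * b) = konst a * konst b" for a b :: 'a by simp
    show "konst 1 = (1 :: 'a poly poly poly)" by (simp only: one_pCons)
  qed (fact c q)+
qed

section \<open>Shift automorphisms\<close>

lemma ring_hom_dan_class:
  assumes "\<phi> \<in> ring_hom (dan_alg c q) (dan_alg c q)"
  shows "\<phi> (dan_class c q (s + t)) = \<phi> (dan_class c q s) \<oplus>\<^bsub>dan_alg c q\<^esub> \<phi> (dan_class c q t)"
    and "\<phi> (dan_class c q (s * t)) = \<phi> (dan_class c q s) \<otimes>\<^bsub>dan_alg c q\<^esub> \<phi> (dan_class c q t)"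
  using ring_hom_add[OF assms] ring_hom_mult[OF assms]
  by (simp_all add: carrier_dan_alg flip: dan_class_add dan_class_mult)

lemma shift_on_polynomials:
  assumes hom: "\<phi> \<in> ring_hom (dan_alg c q) (dan_alg c q)"
    and const: "\<And>a. \<phi> (dan_const c q a) = dan_const c q a"
    and x: "\<phi> (xbar c q) = xbar c q" and y: "\<phi> (ybar c q) = dan_class c q [:[:h, 1:]:]"
  shows "\<phi> (dan_class c q [:p:]) = dan_class c q [:pcompose p [:h, 1:]:]"
proof (induction p)
  case 0
  show ?case using const[of 0] by (simp add: dan_const_def)
next
  case (pCons f p)
  have f: "\<phi> (dan_class c q [:[:f:]:]) = dan_class c q [:[:f:]:]"
    by (rule polynomial_x_induct)
      (use x const in \<open>simp_all add: ring_hom_dan_class[OF hom] dan_class_add dan_class_mult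
        dan_const_def xbar_def\<close>)
  have eq: "[:pCons f p:] = [:[:f:]:] + var_y * [:p:]" by simp
  have "\<phi> (dan_class c q [:pCons f p:]) =
      dan_class c q ([:[:f:]:] + [:[:h, 1:]:] * [:pcompose p [:h, 1:]:])"
    unfolding eq ring_hom_dan_class[OF hom] f y[unfolded ybar_def] pCons.IH
    by (simp only: dan_class_add dan_class_mult)
  also have "[:[:f:]:] + [:[:h, 1:]:] * [:pcompose p [:h, 1:]:] = [:pcompose (pCons f p) [:h, 1:]:]"
    by (simp add: pcompose_pCons)
  finally show ?case .
qed

text \<open>
  Multiplying by a power of \<open>c\<close>, which the shift fixes, turns the element into a polynomial in \<open>y\<close>
  over $k[x]$ that the shift changes by a constant. Such a polynomial is at most linear in \<open>y\<close>,
  and as \<open>q\<close> has degree at least 2, there are no proper denominators in this degree.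
\<close>

lemma shift_difference_is_polynomial:
  fixes c :: "'a::field_char_0 poly"
  assumes c: "c \<noteq> 0" and q: "quasi_monic q" "degree q \<ge> 2"
    and hom: "\<phi> \<in> ring_hom (dan_alg c q) (dan_alg c q)"
    and shift: "\<And>p. \<phi> (dan_class c q [:p:]) = dan_class c q [:pcompose p [:h, 1:]:]"
    and h: "h \<noteq> 0"
    and diff: "\<phi> (dan_class c q t) = dan_class c q (t + [:[:g:]:])"
  obtains b f where "dan_class c q t = dan_class c q [:[:f, b:]:]" "b * h = g"
proof -
  obtain n p where np: "dan_rel c q dvd [:[:c ^ n:]:] * t - [:p:]"
    using clear_denominators by blast
  have "dan_class c q [:pcompose p [:h, 1:]:] = \<phi> (dan_class c q ([:[:c ^ n:]:] * t))"
    using np by (simp flip: shift add: dan_class_eq_iff[THEN iffD2])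
  also have "\<dots> = dan_class c q [:[:c ^ n:]:] \<otimes>\<^bsub>dan_alg c q\<^esub> dan_class c q (t + [:[:g:]:])"
    unfolding ring_hom_dan_class[OF hom] diff shift by simp
  also have "\<dots> = dan_class c q ([:[:c ^ n:]:] * t + [:[:c ^ n * g:]:])"
    by (simp add: dan_class_mult algebra_simps smult_add_right)
  also have "\<dots> = dan_class c q [:p + [:c ^ n * g:]:]"
  proof -
    have "[:[:c ^ n:]:] * t + [:[:c ^ n * g:]:] - [:p + [:c ^ n * g:]:] = [:[:c ^ n:]:] * t - [:p:]"
      by simp
    then show ?thesis using np by (simp only: dan_class_eq_iff)
  qed
  finally have "pcompose p [:h, 1:] = p + [:c ^ n * g:]"
    by (rule dan_class_xy_inj[OF c])
  then have "smult h p = [:h * coeff p 0, c ^ n * g:]" by (rule shift_difference_const[OF h])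
  then have "degree (smult h p) \<le> 1" by simp
  then have p1: "degree p \<le> 1" using h by simp
  then obtain p' where p': "degree p' \<le> degree p" "dan_rel c q dvd t - [:p':]"
    using low_degree_is_polynomial[OF c q(1) _ np] q(2) by auto
  have t: "dan_class c q t = dan_class c q [:p':]" using p' by (simp add: dan_class_eq_iff)
  have "dan_class c q [:pcompose p' [:h, 1:]:] = \<phi> (dan_class c q t)" unfolding t shift ..
  also have "\<dots> = dan_class c q t \<oplus>\<^bsub>dan_alg c q\<^esub> dan_class c q [:[:g:]:]"
    unfolding diff dan_class_add ..
  also have "\<dots> = dan_class c q [:p' + [:g:]:]" unfolding t dan_class_add by simp
  finally have "pcompose p' [:h, 1:] = p' + [:g:]" by (rule dan_class_xy_inj[OF c])
  then have "smult h p' = [:h * coeff p' 0, g:]" by (rule shift_difference_const[OF h])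
  then have "coeff (smult h p') 1 = g" by simp
  then have "coeff p' 1 * h = g" by (simp add: mult.commute)
  moreover have "p' = [:coeff p' 0, coeff p' 1:]"
    using p'(1) p1 by (intro poly_eqI) (auto simp: coeff_pCons coeff_eq_0 split: nat.splits)
  ultimately show ?thesis using that t by metis
qed

text \<open>
  Some \<open>c ^ n t\<close> is a polynomial in \<open>x\<close> and \<open>y\<close>, and \<open>c\<close> can be cancelled.
\<close>

lemma identity_on_polynomials_is_identity:
  fixes c :: "'a::field poly"
  assumes c: "c \<noteq> 0" and q: "quasi_monic q" "degree q > 0"
    and hom: "\<phi> \<in> ring_hom (dan_alg c q) (dan_alg c q)"
    and id: "\<And>p. \<phi> (dan_class c q [:p:]) = dan_class c q [:p:]"
  shows "\<phi> (dan_class c q t) = dan_class c q t"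
proof -
  obtain n p where np: "dan_rel c q dvd [:[:c ^ n:]:] * t - [:p:]"
    using clear_denominators by blast
  have "\<phi> (dan_class c q t) \<in> range (dan_class c q)"
    using ring_hom_closed[OF hom, of "dan_class c q t"] by (simp add: carrier_dan_alg)
  then obtain s where s: "\<phi> (dan_class c q t) = dan_class c q s" by blast
  have "\<phi> (dan_class c q ([:[:c ^ n:]:] * t)) = dan_class c q ([:[:c ^ n:]:] * t)"
    using np id[of p] by (metis dan_class_eq_iff)
  then have "dan_class c q ([:[:c ^ n:]:] * s) = dan_class c q ([:[:c ^ n:]:] * t)"
    unfolding ring_hom_dan_class[OF hom] s id dan_class_mult .
  then have "dan_rel c q dvd [:[:c ^ n:]:] * (s - t)"
    unfolding dan_class_eq_iff by (simp only: right_diff_distrib)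
  then show ?thesis
    using dan_rel_cancel_const_power[OF c q] by (simp add: s dan_class_eq_iff)
qed

section \<open>Automorphisms commuting with a simple derivation of $A_{c,q}$\<close>

locale danielewski_derivation =
  fixes c :: "'a::{alg_closed_field,field_char_0} poly" and q D
  assumes c: "c \<noteq> 0" and q: "quasi_monic q" "degree q \<ge> 2" and D: "D \<in> dan_Der c q"
begin

abbreviation "A \<equiv> dan_alg c q"
abbreviation "cls \<equiv> dan_class c q"

sublocale A: cring A by (rule dan_alg_cring)

lemma cls_carrier: "cls t \<in> carrier A" by (simp add: carrier_dan_alg)

lemma D_carrier: "f \<in> carrier A \<Longrightarrow> D f \<in> carrier A"
  using D by (auto simp: dan_Der_def Let_def)

lemma D_cls: obtains t where "D (cls s) = cls t"
  using D_carrier[OF cls_carrier, of s] by (auto simp: carrier_dan_alg)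

lemma D_add: "f \<in> carrier A \<Longrightarrow> g \<in> carrier A \<Longrightarrow> D (f \<oplus>\<^bsub>A\<^esub> g) = D f \<oplus>\<^bsub>A\<^esub> D g"
  using D by (auto simp: dan_Der_def Let_def)

lemma D_scalar: "f \<in> carrier A \<Longrightarrow> D (dan_const c q a \<otimes>\<^bsub>A\<^esub> f) = dan_const c q a \<otimes>\<^bsub>A\<^esub> D f"
  using D by (auto simp: dan_Der_def Let_def)

lemma D_mult: "f \<in> carrier A \<Longrightarrow> g \<in> carrier A \<Longrightarrow>
    D (f \<otimes>\<^bsub>A\<^esub> g) = (D f \<otimes>\<^bsub>A\<^esub> g) \<oplus>\<^bsub>A\<^esub> (f \<otimes>\<^bsub>A\<^esub> D g)"
  using D by (auto simp: dan_Der_def Let_def)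

lemma D_const: "D (dan_const c q a) = cls 0"
proof -
  have 1: "cls 1 \<otimes>\<^bsub>A\<^esub> cls 1 = cls 1" by (simp add: dan_class_mult)
  obtain t where t: "D (cls 1) = cls t" by (rule D_cls)
  have "cls t = cls (t + t)"
    using D_mult[OF cls_carrier cls_carrier, of 1 1]
    unfolding 1 t by (simp add: dan_class_mult dan_class_add)
  then have "cls t = cls 0" by (simp add: dan_class_eq_iff)
  then show ?thesis
    using D_scalar[OF cls_carrier, of a 1] t by (simp add: dan_const_def dan_class_mult)
qed

lemma D_chain_rule:
  assumes "D (xbar c q) = cls [:[:f:]:]"
  shows "D (cls [:[:g:]:]) = cls [:[:pderiv g * f:]:]"
proof (induction g)
  case 0
  show ?case using D_const[of 0] by (simp add: dan_const_def)
next
  case (pCons a g)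
  have eq: "[:[:pCons a g:]:] = konst a + var_x * [:[:g:]:]" by simp
  have "D (cls [:[:pCons a g:]:]) =
    D (cls (konst a)) \<oplus>\<^bsub>A\<^esub> (D (cls var_x) \<otimes>\<^bsub>A\<^esub> cls [:[:g:]:] \<oplus>\<^bsub>A\<^esub> cls var_x \<otimes>\<^bsub>A\<^esub> D (cls [:[:g:]:]))"
    unfolding eq dan_class_add[symmetric] dan_class_mult[symmetric]
    by (simp add: D_add D_mult cls_carrier)
  also have "\<dots> = cls (0 + ([:[:f:]:] * [:[:g:]:] + var_x * [:[:pderiv g * f:]:]))"
    using D_const[of a] assms pCons.IH
    by (simp only: dan_const_def xbar_def dan_class_add dan_class_mult)
  also have "0 + ([:[:f:]:] * [:[:g:]:] + var_x * [:[:pderiv g * f:]:]) = [:[:pderiv (pCons a g) * f:]:]"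
    by (simp add: pderiv_pCons algebra_simps)
  finally show ?case .
qed

text \<open>
  As every \<open>g\<close> is congruent modulo \<open>m\<close> to a scalar \<open>a\<close>, and \<open>\<phi>\<close> maps \<open>g - a\<close> into \<open>m\<close> again,
  \<open>\<phi> g\<close> and \<open>g\<close> have the same residue.
\<close>

lemma commuting_automorphism_fixing_maximal_ideal_is_identity:
  assumes simple: "simple_der A D"
    and hom: "\<phi> \<in> ring_hom A A"
    and const: "\<And>a. \<phi> (dan_const c q a) = dan_const c q a"
    and comm: "\<And>f. f \<in> carrier A \<Longrightarrow> \<phi> (D f) = D (\<phi> f)"
    and m: "maximalideal m A" "\<phi> ` m = m"
    and f: "f \<in> carrier A"
  shows "\<phi> f = f"
proof -
  interpret m: maximalideal m A by (rule m)
  interpret surface_maximal_ideal "{t. cls t \<in> m}" c q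
    by (rule maximalideal_preimage[OF m(1) c q(1)]) (use q(2) in simp)
  have res: "\<phi> g \<ominus>\<^bsub>A\<^esub> g \<in> m" if g: "g \<in> carrier A" for g
  proof -
    obtain t where t: "g = cls t" using g by (auto simp: carrier_dan_alg)
    obtain a where a: "cls (t - konst a) \<in> m" using residue_is_scalar[of t] by blast
    obtain s where s: "\<phi> g = cls s"
      using ring_hom_closed[OF hom g] by (auto simp: carrier_dan_alg)
    have "cls t = cls ((t - konst a) + konst a)" by simp
    then have "cls s = \<phi> (cls (t - konst a)) \<oplus>\<^bsub>A\<^esub> cls (konst a)"
      using s const[of a] unfolding t dan_const_def ring_hom_dan_class(1)[OF hom, symmetric]
      by (metis ring_hom_dan_class(1)[OF hom])
    moreover obtain r where r: "\<phi> (cls (t - konst a)) = cls r"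
      using ring_hom_closed[OF hom cls_carrier] by (auto simp: carrier_dan_alg)
    ultimately have "cls (s - t) = cls (r - (t - konst a))"
      by (simp add: dan_class_add dan_class_eq_iff algebra_simps)
    moreover have "cls r \<in> m" using a m(2) r by (metis imageI)
    then have "cls (r - (t - konst a)) \<in> m"
      using diff[of r "t - konst a"] a by simp
    ultimately show ?thesis unfolding s unfolding t dan_minus by (simp only:)
  qed
  show ?thesis
    by (rule A.commuting_endomorphism_fixing_residues_is_identity
        [OF _ D_add D_mult simple hom comm m.ideal_axioms m.I_notcarr[symmetric] res f])
      (use D_carrier in auto)
qed

text \<open>
  The projection of the surface $c(x)z = q(x,y)$ to the $x$-line is surjective. This is what makes
  the ideal $(x - a)$ of $A_{c,q}$ proper.
\<close>

lemma exists_point: "\<exists>b z. poly c a * z = poly (poly q [:b:]) a"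
proof (cases "poly c a = 0")
  case True
  define qa where "qa = map_poly (\<lambda>f. poly f a) q"
  obtain r where "r \<noteq> 0" "lead_coeff q = [:r:]" using lead_coeff_quasi_monic[OF q(1)] .
  then have "coeff qa (degree q) \<noteq> 0" by (simp add: qa_def coeff_map_poly)
  then have "degree qa > 0" using q(2) le_degree[of qa "degree q"] by auto
  then obtain b where "poly qa b = 0" using alg_closed_imp_poly_has_root by blast
  then show ?thesis using True by (auto simp: qa_def poly_poly_eq)
next
  case False
  then show ?thesis by (intro exI[of _ 0] exI[of _ "poly (poly q [:0:]) a / poly c a"]) simp
qed

lemma fibre_ideal_proper:
  "PIdl\<^bsub>A\<^esub> (cls (var_x - konst a)) \<noteq> {\<zero>\<^bsub>A\<^esub>}"
  "PIdl\<^bsub>A\<^esub> (cls (var_x - konst a)) \<noteq> carrier A"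
proof
  assume "PIdl\<^bsub>A\<^esub> (cls (var_x - konst a)) = {\<zero>\<^bsub>A\<^esub>}"
  then have "cls (var_x - konst a) = cls 0"
    using A.cgenideal_self[OF cls_carrier] by (auto simp: dan_zero)
  then have "cls [:[:[:-a, 1:]:]:] = cls [:0:]" by simp
  then have "[:[:-a, 1:]:] = 0" by (rule dan_class_xy_inj[OF c])
  then show False by simp
next
  show "PIdl\<^bsub>A\<^esub> (cls (var_x - konst a)) \<noteq> carrier A"
  proof
    assume "PIdl\<^bsub>A\<^esub> (cls (var_x - konst a)) = carrier A"
    then have "cls 1 \<in> PIdl\<^bsub>A\<^esub> (cls (var_x - konst a))" using cls_carrier by simp
    then obtain w where "cls 1 = cls (w * (var_x - konst a))"
      by (auto simp: cgenideal_def carrier_dan_alg dan_class_mult)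
    then obtain s where s: "1 - w * (var_x - konst a) = dan_rel c q * s"
      by (auto simp: dan_class_eq_iff elim: dvdE)
    obtain b z where bz: "poly c a * z = poly (poly q [:b:]) a" using exists_point by blast
    \<comment> \<open>Evaluation at the point \<open>(a, b, z)\<close> of the surface.\<close>
    define ev where "ev = (\<lambda>t. poly (poly (poly t [:[:z:]:]) [:b:]) a)"
    have "ev (1 - w * (var_x - konst a)) = 1" by (simp add: ev_def)
    moreover have "ev (dan_rel c q * s) = 0" using bz by (simp add: ev_def dan_rel_def algebra_simps)
    ultimately show False using s by simp
  qed
qed

text \<open>
  If \<open>a\<close> were a root of \<open>f\<close>, then $D(x - a) = f(x)$ would be a multiple of $x - a$, and the
  nonzero proper ideal $(x - a)$ would be stable under \<open>D\<close>.
\<close>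

lemma simple_derivative_of_x_is_const:
  assumes simple: "simple_der A D" and Dx: "D (xbar c q) = cls [:[:f:]:]"
  obtains e where "e \<noteq> 0" "f = [:e:]"
proof -
  have "poly f a \<noteq> 0" for a
  proof
    assume "poly f a = 0"
    then obtain g where g: "f = [:-a, 1:] * g" by (metis poly_eq_0_iff_dvd dvdE)
    define I where "I = PIdl\<^bsub>A\<^esub> (cls (var_x - konst a))"
    have I: "ideal I A" unfolding I_def by (rule A.cgenideal_ideal[OF cls_carrier])
    have mem: "cls (t * (var_x - konst a)) \<in> I" for t
      using cls_carrier[of t] unfolding I_def cgenideal_def dan_class_mult[symmetric] by blast
    have "D (cls (var_x - konst a)) = cls [:[:f:]:]"
      using D_chain_rule[OF Dx, of "[:-a, 1:]"] by (simp add: pderiv_pCons)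
    also have "[:[:f:]:] = [:[:g:]:] * (var_x - konst a)" by (simp add: g algebra_simps)
    finally have Da: "D (cls (var_x - konst a)) = cls ([:[:g:]:] * (var_x - konst a))" .
    have "D ` I \<subseteq> I"
    proof
      fix u assume "u \<in> D ` I"
      then obtain t where u: "u = D (cls t \<otimes>\<^bsub>A\<^esub> cls (var_x - konst a))"
        by (auto simp: I_def cgenideal_def carrier_dan_alg)
      obtain s where s: "D (cls t) = cls s" by (rule D_cls)
      have "u = cls ((s + t * [:[:g:]:]) * (var_x - konst a))"
        unfolding u D_mult[OF cls_carrier cls_carrier] s Da
        unfolding dan_class_mult dan_class_add by (simp only: algebra_simps)
      then show "u \<in> I" using mem by simp
    qed
    then show False
      using simple I fibre_ideal_proper[of a] by (auto simp: simple_der_def I_def)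
  qed
  then have "degree f = 0" using alg_closed_imp_poly_has_root[of f] by auto
  then obtain e where "f = [:e:]" by (rule degree_eq_zeroE)
  moreover from this have "e \<noteq> 0" using \<open>\<And>a. poly f a \<noteq> 0\<close>[of 0] by simp
  ultimately show ?thesis using that by blast
qed

text \<open>
  Suppose that \<open>h = c l\<close> is not zero. Both \<open>D x\<close> and \<open>D y\<close> are changed by the shift by an element
  of $k[x]$, namely by 0 and by \<open>D h\<close>. The first fact makes \<open>D x\<close> a polynomial in \<open>x\<close>, hence a
  nonzero scalar \<open>e\<close> by simplicity. The second then gives \<open>b h = e h'\<close> for some \<open>b\<close> in $k[x]$.
  This contradicts the degrees, because \<open>h\<close> is not constant.
\<close>

lemma commuting_shift_is_trivial:
  assumes dc: "degree c > 0" and simple: "simple_der A D"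
    and hom: "\<phi> \<in> ring_hom A A"
    and const: "\<And>a. \<phi> (dan_const c q a) = dan_const c q a"
    and x: "\<phi> (xbar c q) = xbar c q" and y: "\<phi> (ybar c q) = cls [:[:c * l, 1:]:]"
    and comm: "\<And>f. f \<in> carrier A \<Longrightarrow> \<phi> (D f) = D (\<phi> f)"
  shows "l = 0"
proof (rule ccontr)
  assume l: "l \<noteq> 0"
  define h where "h = c * l"
  have h: "h \<noteq> 0" "degree h > 0" using l c dc by (simp_all add: h_def degree_mult_eq)
  note shift = shift_on_polynomials[OF hom const x y, folded h_def]
  note diff = shift_difference_is_polynomial[OF c q hom shift h(1)]
  have xc: "xbar c q \<in> carrier A" "ybar c q \<in> carrier A"
    by (simp_all add: xbar_def ybar_def cls_carrier)
  obtain t where t: "D (xbar c q) = cls t" unfolding xbar_def by (rule D_cls)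
  have "\<phi> (cls t) = cls (t + [:[:0:]:])" using comm[OF xc(1)] x t by simp
  then obtain b f where bf: "cls t = cls [:[:f, b:]:]" "b * h = 0" by (rule diff)
  then have Dx: "D (xbar c q) = cls [:[:f:]:]" using t h by simp
  obtain e where e: "e \<noteq> 0" "f = [:e:]" by (rule simple_derivative_of_x_is_const[OF simple Dx])
  obtain s where s: "D (ybar c q) = cls s" unfolding ybar_def by (rule D_cls)
  have "\<phi> (cls s) = D (cls [:[:h, 1:]:])" using comm[OF xc(2)] s y by (simp add: h_def)
  also have "[:[:h, 1:]:] = var_y + [:[:h:]:]" by simp
  also have "D (cls (var_y + [:[:h:]:])) = cls (s + [:[:pderiv h * f:]:])"
    unfolding dan_class_add[symmetric] D_add[OF cls_carrier cls_carrier] D_chain_rule[OF Dx]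
    using s by (simp add: ybar_def)
  finally obtain b' f' where "b' * h = pderiv h * f" by (rule diff)
  then have "b' * h = smult e (pderiv h)" by (simp add: e)
  then have "h dvd smult e (pderiv h)" by (metis dvd_triv_right)
  then have "h dvd pderiv h" using e(1) by (simp add: dvd_smult_iff)
  then show False using h(2) by simp
qed

end

theorem proposition10:
  fixes c :: "'a::{alg_closed_field, field_char_0} poly"
    and q :: "'a poly poly"
    and D :: "'a poly poly poly set \<Rightarrow> 'a poly poly poly set"
  assumes "reduced_form c q"
    and "degree c \<ge> 2"
    and "degree q \<ge> 2"
    and "D \<in> dan_Der c q"
    and "simple_der (dan_alg c q) D"
    and "\<And>\<sigma>. \<sigma> \<in> dan_Aut c q \<Longrightarrow> dan_psi c q \<sigma> \<noteq> (1, 1) \<Longrightarrow>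
           \<exists>m. maximalideal m (dan_alg c q) \<and> \<sigma> ` m = m"
  shows "dan_Aut_D c q D = {\<lambda>f\<in>carrier (dan_alg c q). f}"
proof -
  have c: "c \<noteq> 0" and qm: "quasi_monic q" using assms(1,2) by (auto simp: reduced_form_def)
  interpret danielewski_derivation c q D by unfold_locales (fact c qm assms)+
  have id: "\<phi> = (\<lambda>f\<in>carrier A. f)" if \<phi>: "\<phi> \<in> dan_Aut_D c q D" for \<phi>
  proof -
    have aut: "\<phi> \<in> dan_Aut c q" and comm: "\<And>f. f \<in> carrier A \<Longrightarrow> \<phi> (D f) = D (\<phi> f)"
      using \<phi> by (auto simp: dan_Aut_D_def)
    have hom: "\<phi> \<in> ring_hom A A" and ext: "\<phi> \<in> extensional (carrier A)"
      and const: "\<And>a. \<phi> (dan_const c q a) = dan_const c q a"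
      using aut by (auto simp: dan_Aut_def ring_iso_def)
    have "\<phi> f = f" if f: "f \<in> carrier A" for f
    proof (cases "dan_psi c q \<phi> = (1, 1)")
      case True
      \<comment> \<open>The default value \<open>(0, 0)\<close> of \<open>dan_psi\<close> differs from \<open>(1, 1)\<close>, so \<open>\<phi>\<close> has weights.\<close>
      then have "has_weights c q \<phi> (1, 1)"
        using dan_psi_eq[OF c] unfolding dan_psi_def by (metis prod.inject zero_neq_one)
      then obtain l where x: "\<phi> (xbar c q) = xbar c q"
        and y: "\<phi> (ybar c q) = cls [:[:c * l, 1:]:]"
        by (auto simp: has_weights_def Let_def xbar_def ybar_def at_xbar_def dan_const_def
            dan_class_mult dan_class_add simp flip: one_pCons)
      have "l = 0"
        by (rule commuting_shift_is_trivial[OF _ assms(5) hom const x y comm]) (use assms(2) in auto)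
      then have "\<phi> (cls [:p:]) = cls [:p:]" for p
        using shift_on_polynomials[OF hom const x y, of p] by simp
      then show ?thesis
        using identity_on_polynomials_is_identity[OF c qm _ hom] f assms(3)
        by (auto simp: carrier_dan_alg)
    next
      case False
      then obtain m where m: "maximalideal m A" "\<phi> ` m = m" using assms(6) aut by blast
      then show ?thesis
        using commuting_automorphism_fixing_maximal_ideal_is_identity[OF assms(5) hom const comm _ _ f]
        by blast
    qed
    then show ?thesis using ext by (auto simp: fun_eq_iff extensional_def)
  qed
  moreover have "(\<lambda>f\<in>carrier A. f) \<in> dan_Aut_D c q D"
  proof -
    have "(\<lambda>f\<in>carrier A. f) \<in> ring_iso A A"
      by (rule ring_iso_memI) (auto simp: bij_betw_def inj_on_def)
    then show ?thesis
      by (auto simp: dan_Aut_D_def dan_Aut_def dan_const_def cls_carrier D_carrier)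
  qed
  ultimately show ?thesis by blast
qed

end
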